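(* Let $\mathbb{X}\in\{\mathbb{N},\mathbb{Z}\}$, let $S$ be a finite alphabet, and let $X\subset S^{\mathbb{X}}$ be a subshift with $h(W(X)) \geq \log_2 k$, and let $1 > \epsilon > 0$ be such that $\left(\frac{2e}{\epsilon}\right)^{\epsilon} < k$. Then $h(X) \geq \epsilon \log_2 |S|$. In particular, if $h(W(X)) > 0$, then $h(X) > 0$.
   Context: Here $k$ is a real number, $S^*$ is the set of finite words over $S$ (including the empty word), $0\in\mathbb{N}$, and $e$ is the base of the natural logarithm. Games: let $n \in \mathbb{N}$ or $n=\mathbb{N}$, let $X \subset S^n$ and $a \in \{A,B\}^n$ (the turn order). Two players $A$ and $B$ build a word (infinite sequence if $n=\mathbb{N}$) $w \in S^n$ one letter at a time, starting from coordinate $0$; the letter $w_i$ is chosen by player $a_i$, knowing $w_0\cdots w_{i-1}$. Player $A$ wins if $w \in X$, otherwise $B$ wins. A strategy is a function assigning a letter of $S$ to each finite word of length less than $n$ (any finite word if $n=\mathbb{N}$); a strategy of $A$ is winning if the resulting word lies in $X$ whatever strategy $B$ uses. The winning set is $W(X) = \{a \in \{A,B\}^n : A \text{ has a winning strategy for the game with target set } X \text{ and turn order } a\}$. For a language $L \subset S^*$, $W(L) = \bigcup_{n\in\mathbb{N}} W(L\cap S^n)$. Subshifts: for $F \subset S^*$, let $\mathcal{X}_F$ be the set of $x \in S^{\mathbb{X}}$ in which no word of $F$ appears as a contiguous factor; subshifts are exactly the sets of this form. $\mathcal{B}_n(X)$ is the set of words of length $n$ appearing in points of $X$, and $\mathcal{B}(X)=\bigcup_n\mathcal{B}_n(X)$.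 The entropy is $h(X) = \lim_{n\to\infty}\frac1n\log_2|\mathcal{B}_n(X)|$. Winning shifts: for a subshift $X\subset S^{\mathbb{N}}$, the winning shift is the winning set $W(X)\subset\{A,B\}^{\mathbb N}$, that is, the set of all $a\in\{A,B\}^{\mathbb N}$ such that $A$ has a winning strategy for the game with $n=\mathbb{N}$, target set $X$ and turn order $a$. For a subshift $X \subset S^{\mathbb{Z}}$, it is the two-directional subshift $W(X) = \mathcal{X}_F \subset \{A,B\}^{\mathbb{Z}}$ with $F = \{A,B\}^* \setminus W(\mathcal{B}(X))$.
   Formalization: The final claim (h(W(X)) > 0 implies h(X) > 0) is stated only for alphabets with at least two letters; it fails for |S| = 1, where the one-point subshift has h(W(X)) = 1 but h(X) = 0. *)

theory Defs
  imports Complex_Main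
begin

datatype player = PlayerA | PlayerB

text \<open>
  A strategy is a total function on all finite words; in a game of length \<open>n\<close> only its values on
  words of length less than \<open>n\<close> matter.
\<close>

type_synonym 's strategy = "'s list \<Rightarrow> 's"

fun move :: "player \<Rightarrow> 's strategy \<Rightarrow> 's strategy \<Rightarrow> 's strategy" where
  "move PlayerA \<sigma> \<tau> = \<sigma>"
| "move PlayerB \<sigma> \<tau> = \<tau>"

text \<open>\<open>play a \<sigma> \<tau> n\<close> is the word built after \<open>n\<close> moves, with \<open>\<sigma>\<close> used by A and \<open>\<tau>\<close> by B.\<close>

fun play :: "(nat \<Rightarrow> player) \<Rightarrow> 's strategy \<Rightarrow> 's strategy \<Rightarrow> nat \<Rightarrow> 's list" where
  "play a \<sigma> \<tau> 0 = []"
| "play a \<sigma> \<tau> (Suc n) = (let u = play a \<sigma> \<tau> n in u @ [move (a n) \<sigma> \<tau> u])"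

definition infinite_play :: "(nat \<Rightarrow> player) \<Rightarrow> 's strategy \<Rightarrow> 's strategy \<Rightarrow> nat \<Rightarrow> 's" where
  "infinite_play a \<sigma> \<tau> = (\<lambda>n. move (a n) \<sigma> \<tau> (play a \<sigma> \<tau> n))"

definition winning_set :: "nat \<Rightarrow> 's list set \<Rightarrow> player list set" where
  "winning_set n X = {a. length a = n \<and> (\<exists>\<sigma>. \<forall>\<tau>. play (\<lambda>i. a ! i) \<sigma> \<tau> n \<in> X)}"

definition winning_language :: "'s list set \<Rightarrow> player list set" where
  "winning_language L = (\<Union>n. winning_set n {w \<in> L. length w = n})"

text \<open>
  Points are functions on an index type; the definitions below are used at the index types
  \<^typ>\<open>nat\<close> (one-sided shifts) and \<^typ>\<open>int\<close> (two-sided shifts).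
\<close>

definition occurs_in :: "'s list \<Rightarrow> ('i::semiring_1 \<Rightarrow> 's) \<Rightarrow> bool" where
  "occurs_in w x \<longleftrightarrow> (\<exists>i. \<forall>j < length w. x (i + of_nat j) = w ! j)"

definition shift_avoiding :: "'s list set \<Rightarrow> ('i::semiring_1 \<Rightarrow> 's) set" where
  "shift_avoiding F = {x. \<forall>w \<in> F. \<not> occurs_in w x}"

definition subshift :: "('i::semiring_1 \<Rightarrow> 's) set \<Rightarrow> bool" where
  "subshift X \<longleftrightarrow> (\<exists>F. X = shift_avoiding F)"

definition blocks :: "nat \<Rightarrow> ('i::semiring_1 \<Rightarrow> 's) set \<Rightarrow> 's list set" where
  "blocks n X = {w. length w = n \<and> (\<exists>x \<in> X. occurs_in w x)}"

definition shift_language :: "('i::semiring_1 \<Rightarrow> 's) set \<Rightarrow> 's list set" where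
  "shift_language X = (\<Union>n. blocks n X)"

text \<open>
  The limit exists by subadditivity. Since \<open>log 2 0 = 0\<close> in HOL, the empty subshift gets
  entropy \<open>0\<close> here (rather than minus infinity).
\<close>

definition entropy :: "('i::semiring_1 \<Rightarrow> 's) set \<Rightarrow> real" where
  "entropy X = lim (\<lambda>n. log 2 (real (card (blocks n X))) / real n)"

definition winning_shift_nat :: "(nat \<Rightarrow> 's) set \<Rightarrow> (nat \<Rightarrow> player) set" where
  "winning_shift_nat X = {a. \<exists>\<sigma>. \<forall>\<tau>. infinite_play a \<sigma> \<tau> \<in> X}"

definition winning_shift_int :: "(int \<Rightarrow> 's) set \<Rightarrow> (int \<Rightarrow> player) set" where
  "winning_shift_int X = shift_avoiding (UNIV - winning_language (shift_language X))"

end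

theory Submission
  imports Defs "HOL-Real_Asymp.Real_Asymp"
begin

text \<open>
  If A wins for the turn order \<open>a\<close> of length \<open>n\<close>, the moves of B are free, so the target set has at
  least \<open>|S|\<^sup>m\<close> elements, where \<open>m\<close> is the number of turns of B in \<open>a\<close>. Every block of \<open>W(X)\<close> of length
  \<open>n\<close> is a winning turn order for the blocks of \<open>X\<close> of length \<open>n\<close>, and at most \<open>(e/\<epsilon>)\<close> to the
  \<open>\<epsilon>n\<close> turn orders have at most \<open>\<epsilon>n\<close> turns of B. If \<open>W(X)\<close> has more blocks than that,
  then some winning turn order has more than \<open>\<epsilon>n\<close> turns of B.
\<close>

subsection \<open>Subadditivity and entropy\<close>

lemma subadditive_mult_le:
  fixes f :: "nat \<Rightarrow> real"
  assumes sub: "\<And>m n. f (m + n) \<le> f m + f n"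
  shows "f (q * m + r) \<le> real q * f m + f r"
proof (induction q)
  case (Suc q)
  have "f (Suc q * m + r) \<le> f m + f (q * m + r)"
    using sub[of m "q * m + r"] by (simp add: add.assoc)
  with Suc show ?case by (simp add: algebra_simps)
qed simp

text \<open>Fekete's lemma: the limit is the infimum of the quotients. If \<open>m\<close> nearly
  attains it, division of \<open>n\<close> by \<open>m\<close> with remainder bounds
  \<open>f n\<close> by about \<open>n / m\<close> copies of \<open>f m\<close> plus a bounded
  error.\<close>

lemma subadditive_convergent:
  fixes f :: "nat \<Rightarrow> real"
  assumes sub: "\<And>m n. f (m + n) \<le> f m + f n" and nonneg: "\<And>n. f n \<ge> 0"
  shows "convergent (\<lambda>n. f n / real n)"
proof -
  \<comment> \<open>The index starts at 1: at \<open>n = 0\<close> the quotient is 0 by convention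
    and would force the infimum to be 0.\<close>
  let ?A = "(\<lambda>n. f n / real n) ` {1..}"
  define L where "L = Inf ?A"
  have bdd: "bdd_below ?A"
    using nonneg by (intro bdd_belowI2[where m = 0]) simp
  have low: "L \<le> f n / real n" if "n \<ge> 1" for n
    unfolding L_def using bdd that by (intro cInf_lower) auto
  have "(\<lambda>n. f n / real n) \<longlonglongrightarrow> L"
  proof (rule tendstoI)
    fix e :: real assume e: "e > 0"
    have "\<exists>y\<in>?A. y < L + e / 2"
      using cInf_lessD[of ?A "L + e / 2"] e unfolding L_def by auto
    then obtain m where m: "m \<ge> 1" "f m / real m < L + e / 2" by auto
    \<comment> \<open>\<open>C\<close> bounds \<open>f\<close> at every remainder modulo
      \<open>m\<close>, independently of \<open>n\<close>, so its share of the quotient tends to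
      0.\<close>
    define C where "C = f 0 + real m * f 1"
    have "(\<lambda>n. C / real n) \<longlonglongrightarrow> 0"
      by real_asymp
    then have "eventually (\<lambda>n. C / real n < e / 2) sequentially"
      using e by (intro order_tendstoD) auto
    then show "eventually (\<lambda>n. dist (f n / real n) L < e) sequentially"
      using eventually_ge_at_top[of 1]
    proof eventually_elim
      case (elim n)
      have "f (n mod m) \<le> real (n mod m) * f 1 + f 0"
        using subadditive_mult_le[of f "n mod m" 1 0, OF sub] by simp
      also have "real (n mod m) * f 1 \<le> real m * f 1"
        using nonneg m(1) by (intro mult_right_mono) auto
      finally have r: "f (n mod m) \<le> C" by (simp add: C_def)
      have "f n \<le> real (n div m) * f m + f (n mod m)"
        using subadditive_mult_le[of f "n div m" m "n mod m", OF sub] by simp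
      also have "real (n div m) * f m \<le> real n / real m * f m"
        using nonneg of_nat_div_le_of_nat[of n m] by (intro mult_right_mono) auto
      finally have "f n \<le> real n / real m * f m + C" using r by simp
      then have "f n / real n \<le> (real n / real m * f m + C) / real n"
        by (rule divide_right_mono) simp
      also have "\<dots> = f m / real m + C / real n"
        using elim(2) by (simp add: field_simps)
      also have "\<dots> < L + e" using m(2) elim(1) by linarith
      finally show ?case using low[OF elim(2)] by (simp add: dist_real_def)
    qed
  qed
  then show ?thesis by (rule convergentI)
qed

lemma finite_blocks [simp]: "finite (blocks n (X :: ('i::semiring_1 \<Rightarrow> 's::finite) set))"
  by (rule finite_subset[OF _ finite_lists_length_eq[of UNIV n]]) (auto simp: blocks_def)

lemma blocks_nonempty:
  assumes "X \<noteq> {}"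
  shows "blocks n (X :: ('i::semiring_1 \<Rightarrow> 's) set) \<noteq> {}"
proof -
  obtain x where "x \<in> X" using assms by blast
  moreover have "occurs_in (map (\<lambda>j. x (of_nat j)) [0..<n]) x"
    unfolding occurs_in_def by (rule exI[of _ 0]) simp
  ultimately have "map (\<lambda>j. x (of_nat j)) [0..<n] \<in> blocks n X"
    by (auto simp: blocks_def)
  then show ?thesis by blast
qed

lemma occurs_in_appendD:
  assumes "occurs_in (u @ v) (x :: 'i::semiring_1 \<Rightarrow> 's)"
  shows "occurs_in u x" "occurs_in v x"
proof -
  obtain i where i: "\<And>j. j < length u + length v \<Longrightarrow> x (i + of_nat j) = (u @ v) ! j"
    using assms by (auto simp: occurs_in_def)
  have "x (i + of_nat j) = u ! j" if "j < length u" for j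
    using i[of j] that by (simp add: nth_append)
  then show "occurs_in u x" unfolding occurs_in_def by blast
  have "x (i + of_nat (length u) + of_nat j) = v ! j" if "j < length v" for j
    using i[of "length u + j"] that by (simp add: add.assoc)
  then show "occurs_in v x" unfolding occurs_in_def by blast
qed

text \<open>Cutting a block after \<open>m\<close> letters leaves two blocks of the same point, and
  the two pieces determine the block.\<close>

lemma card_blocks_add_le:
  fixes X :: "('i::semiring_1 \<Rightarrow> 's::finite) set"
  shows "card (blocks (m + n) X) \<le> card (blocks m X) * card (blocks n X)"
proof -
  have "blocks (m + n) X \<subseteq> (\<lambda>(u, v). u @ v) ` (blocks m X \<times> blocks n X)"
  proof
    fix w assume w: "w \<in> blocks (m + n) X"
    then obtain x where x: "x \<in> X" "occurs_in (take m w @ drop m w) x"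
      by (auto simp: blocks_def)
    then have "take m w \<in> blocks m X" "drop m w \<in> blocks n X"
      using w occurs_in_appendD[OF x(2)] by (auto simp: blocks_def)
    then show "w \<in> (\<lambda>(u, v). u @ v) ` (blocks m X \<times> blocks n X)"
      by (intro image_eqI[of _ _ "(take m w, drop m w)"]) auto
  qed
  then show ?thesis
    by (metis surj_card_le finite_cartesian_product finite_blocks card_cartesian_product)
qed

lemma entropy_LIMSEQ:
  fixes X :: "('i::semiring_1 \<Rightarrow> 's::finite) set"
  shows "(\<lambda>n. log 2 (real (card (blocks n X))) / real n) \<longlonglongrightarrow> entropy X"
proof -
  let ?c = "\<lambda>n. card (blocks n X)"
  have "convergent (\<lambda>n. log 2 (real (?c n)) / real n)"
  \<comment> \<open>For empty \<open>X\<close> the sequence is constantly 0, as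
    \<open>log 2 0 = 0\<close>. Otherwise every count is at least 1, which makes the logarithms
    nonnegative.\<close>
  proof (cases "X = {}")
    case True
    then show ?thesis by (simp add: blocks_def log_def convergent_const)
  next
    case False
    have pos: "?c n > 0" for n
      using blocks_nonempty[OF False] by (simp add: card_gt_0_iff)
    show ?thesis
    proof (rule subadditive_convergent)
      show "log 2 (real (?c (m + n))) \<le> log 2 (real (?c m)) + log 2 (real (?c n))" for m n
      proof -
        have "log 2 (real (?c (m + n))) \<le> log 2 (real (?c m) * real (?c n))"
          using pos[of "m + n"] pos[of m] pos[of n] card_blocks_add_le[of m n X]
          by (simp flip: of_nat_mult)
        also have "\<dots> = log 2 (real (?c m)) + log 2 (real (?c n))"
          using pos by (intro log_mult_pos) auto
        finally show ?thesis .
      qed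
      show "log 2 (real (?c n)) \<ge> 0" for n
        using pos[of n] by (simp add: Suc_le_eq)
    qed
  qed
  then show ?thesis by (simp add: entropy_def convergent_LIMSEQ_iff)
qed

lemma entropy_empty: "entropy ({} :: ('i::semiring_1 \<Rightarrow> 's::finite) set) = 0"
  using entropy_LIMSEQ[of "{} :: ('i \<Rightarrow> 's) set"]
  by (simp add: blocks_def log_def LIMSEQ_const_iff)

subsection \<open>Finite games\<close>

lemma length_play [simp]: "length (play a \<sigma> \<tau> n) = n"
  by (induction n) (auto simp: Let_def)

lemma move_cong:
  assumes "c = PlayerB \<Longrightarrow> \<tau> u = \<tau>' u"
  shows "move c \<sigma> \<tau> u = move c \<sigma> \<tau>' u"
  using assms by (cases c) auto

text \<open>The first \<open>n\<close> moves consult strategies only at words shorter than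
  \<open>n\<close>, so a strategy of B may be altered elsewhere without changing them.\<close>

lemma play_cong:
  assumes "\<And>i. i < n \<Longrightarrow> a i = b i" and "\<And>u. length u < n \<Longrightarrow> \<tau> u = \<tau>' u"
  shows "play a \<sigma> \<tau> n = play b \<sigma> \<tau>' n"
  using assms
proof (induction n)
  case (Suc n)
  then have "play a \<sigma> \<tau> n = play b \<sigma> \<tau>' n" by simp
  then show ?case using Suc.prems by (auto simp: Let_def intro!: move_cong)
qed simp

text \<open>With A's strategy fixed, a turn of A extends each reachable word in exactly one way,
  while a turn of B extends it by any letter.\<close>

lemma card_plays_ge:
  fixes \<sigma> :: "'s::finite strategy"
  shows "card (UNIV :: 's set) ^ card {i. i < n \<and> a i = PlayerB}
           \<le> card (range (\<lambda>\<tau>. play a \<sigma> \<tau> n))"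
proof (induction n)
  case (Suc n)
  let ?P = "\<lambda>n. range (\<lambda>\<tau>. play a \<sigma> \<tau> n)"
  have fin: "finite (?P n)" for n
    by (rule finite_subset[OF _ finite_lists_length_eq[of UNIV n]]) auto
  show ?case
  proof (cases "a n")
    case PlayerA
    have "?P (Suc n) = (\<lambda>u. u @ [\<sigma> u]) ` ?P n"
      using PlayerA by (auto simp: Let_def image_image)
    moreover have "inj_on (\<lambda>u. u @ [\<sigma> u]) (?P n)"
      by (auto intro: inj_onI)
    ultimately have "card (?P (Suc n)) = card (?P n)"
      using card_image by metis
    moreover have "{i. i < Suc n \<and> a i = PlayerB} = {i. i < n \<and> a i = PlayerB}"
      using PlayerA by (auto simp: less_Suc_eq)
    ultimately show ?thesis using Suc by simp
  next
    case PlayerB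
    have "(\<lambda>(u, s). u @ [s]) ` (?P n \<times> UNIV) \<subseteq> ?P (Suc n)"
    proof
      fix w assume "w \<in> (\<lambda>(u, s). u @ [s]) ` (?P n \<times> UNIV)"
      then obtain \<tau> s where w: "w = play a \<sigma> \<tau> n @ [s]" by auto
      \<comment> \<open>Redefining B's answer at a word of length \<open>n\<close> leaves the first
        \<open>n\<close> moves intact and makes the next letter \<open>s\<close>.\<close>
      let ?\<tau> = "\<tau>(play a \<sigma> \<tau> n := s)"
      have "play a \<sigma> ?\<tau> n = play a \<sigma> \<tau> n"
        by (rule play_cong) auto
      then have "w = play a \<sigma> ?\<tau> (Suc n)"
        using PlayerB w by (simp add: Let_def)
      then show "w \<in> ?P (Suc n)" 
        using rangeI[of "\<lambda>\<tau>. play a \<sigma> \<tau> (Suc n)" ?\<tau>] by (simp only:)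
    qed
    moreover have "card ((\<lambda>(u, s). u @ [s]) ` (?P n \<times> (UNIV :: 's set)))
        = card (?P n) * card (UNIV :: 's set)"
      by (subst card_image) (auto simp: card_cartesian_product intro!: inj_onI)
    ultimately have le: "card (?P n) * card (UNIV :: 's set) \<le> card (?P (Suc n))"
      using card_mono[OF fin] by metis
    have "{i. i < Suc n \<and> a i = PlayerB} = insert n {i. i < n \<and> a i = PlayerB}"
      using PlayerB by auto
    then have "card (UNIV :: 's set) ^ card {i. i < Suc n \<and> a i = PlayerB}
        = card (UNIV :: 's set) ^ card {i. i < n \<and> a i = PlayerB} * card (UNIV :: 's set)"
      by simp
    also have "\<dots> \<le> card (?P n) * card (UNIV :: 's set)"
      using Suc by simp
    also note le
    finally show ?thesis .
  qed
qed simp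

lemma winning_set_card_ge:
  fixes X :: "'s::finite list set"
  assumes "a \<in> winning_set n X" "finite X"
  shows "card (UNIV :: 's set) ^ count_list a PlayerB \<le> card X"
proof -
  obtain \<sigma> where len: "length a = n" and \<sigma>: "\<And>\<tau>. play (\<lambda>i. a ! i) \<sigma> \<tau> n \<in> X"
    using assms(1) by (auto simp: winning_set_def)
  have "count_list a PlayerB = card {i. i < n \<and> a ! i = PlayerB}"
    using len by (simp add: count_list_eq_length_filter length_filter_conv_card eq_commute)
  then have "card (UNIV :: 's set) ^ count_list a PlayerB
      \<le> card (range (\<lambda>\<tau>. play (\<lambda>i. a ! i) \<sigma> \<tau> n))"
    using card_plays_ge by metis
  also have "\<dots> \<le> card X"
    using \<sigma> assms(2) by (intro card_mono) auto
  finally show ?thesis .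
qed

subsection \<open>Counting turn orders\<close>

lemma UNIV_player: "UNIV = {PlayerA, PlayerB}"
  by (auto intro: player.exhaust)

instance player :: finite
  by standard (simp add: UNIV_player)

text \<open>The generating function of turn orders by number of B turns: each position contributes a
  factor 1 for A or \<open>t\<close> for B.\<close>

lemma sum_power_count_PlayerB:
  fixes t :: real
  shows "(\<Sum>a | length a = n. t ^ count_list a PlayerB) = (1 + t) ^ n"
proof (induction n)
  case (Suc n)
  let ?L = "{a :: player list. length a = n}"
  have fin: "finite ?L"
    using finite_lists_length_eq[of "UNIV :: player set" n] by simp
  have "{a :: player list. length a = Suc n} = (#) PlayerA ` ?L \<union> (#) PlayerB ` ?L"
    by (auto simp: length_Suc_conv image_iff) (metis player.exhaust)
  then have "(\<Sum>a | length a = Suc n. t ^ count_list a PlayerB)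
      = (\<Sum>a \<in> (#) PlayerA ` ?L. t ^ count_list a PlayerB)
        + (\<Sum>a \<in> (#) PlayerB ` ?L. t ^ count_list a PlayerB)"
    using fin by (simp only:) (intro sum.union_disjoint finite_imageI, auto)
  also have "\<dots> = (1 + t) * (\<Sum>a \<in> ?L. t ^ count_list a PlayerB)"
    by (simp add: sum.reindex sum_distrib_left distrib_right sum.distrib)
  finally show ?case using Suc by simp
qed simp

text \<open>A Chernoff-type bound: give a turn order the weight \<open>\<epsilon>\<close> to the
  number of its B turns. Since \<open>\<epsilon> < 1\<close>, each order counted weighs at least
  \<open>\<epsilon> powr (\<epsilon> * n)\<close>, while all orders together weigh
  \<open>(1 + \<epsilon>) ^ n\<close>, which is at most \<open>exp (\<epsilon> * n)\<close>.\<close>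

lemma card_few_PlayerB_le:
  fixes \<epsilon> :: real
  assumes "0 < \<epsilon>" "\<epsilon> < 1"
  shows "real (card {a. length a = n \<and> real (count_list a PlayerB) \<le> \<epsilon> * real n})
           \<le> (exp 1 / \<epsilon>) powr (\<epsilon> * real n)"
proof -
  let ?M = "{a. length a = n \<and> real (count_list a PlayerB) \<le> \<epsilon> * real n}"
  have fin: "finite {a :: player list. length a = n}"
    using finite_lists_length_eq[of "UNIV :: player set" n] by simp
  have "real (card ?M) * \<epsilon> powr (\<epsilon> * real n) = (\<Sum>a\<in>?M. \<epsilon> powr (\<epsilon> * real n))"
    by simp
  also have "\<dots> \<le> (\<Sum>a\<in>?M. \<epsilon> ^ count_list a PlayerB)"
    using assms by (intro sum_mono) (auto simp flip: powr_realpow intro!: powr_mono')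
  also have "\<dots> \<le> (\<Sum>a | length a = n. \<epsilon> ^ count_list a PlayerB)"
    using fin assms by (intro sum_mono2) auto
  also have "\<dots> = (1 + \<epsilon>) ^ n" by (rule sum_power_count_PlayerB)
  also have "\<dots> \<le> exp \<epsilon> ^ n"
    using assms by (intro power_mono exp_ge_add_one_self) auto
  also have "\<dots> = exp 1 powr (\<epsilon> * real n)"
    by (simp add: powr_def mult.commute flip: exp_of_nat_mult)
  finally show ?thesis
    using assms by (simp add: powr_divide pos_le_divide_eq)
qed

subsection \<open>Entropy of winning shifts\<close>

text \<open>\<open>W\<close> is kept abstract and tied to \<open>X\<close> only through
  \<open>sub\<close>, so that one argument serves one-sided and two-sided winning shifts.\<close>

lemma entropy_ge_of_blocks_winning:
  fixes X :: "('i::semiring_1 \<Rightarrow> 's::finite) set" and W :: "('i \<Rightarrow> player) set"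
  assumes sub: "\<And>n. blocks n W \<subseteq> winning_set n (blocks n X)"
    and \<epsilon>: "0 < \<epsilon>" "\<epsilon> < 1" and h: "log 2 k \<le> entropy W" and k: "(2 * exp 1 / \<epsilon>) powr \<epsilon> < k"
  shows "\<epsilon> * log 2 (real (card (UNIV :: 's set))) \<le> entropy X"
proof -
  let ?S = "card (UNIV :: 's set)"
  have S: "?S \<ge> 1" by (simp add: Suc_le_eq card_gt_0_iff)
  \<comment> \<open>\<open>b\<close> is the growth rate per letter in the bound on turn orders with
    few B turns.\<close>
  define b where "b = (exp 1 / \<epsilon>) powr \<epsilon>"
  have "exp 1 / \<epsilon> > 1"
    using \<epsilon> exp_gt_one[of "1::real"] by (simp add: pos_less_divide_eq del: one_less_exp_iff)
  then have b1: "b > 1" using \<epsilon> by (simp add: b_def)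
  have "b \<le> (2 * exp 1 / \<epsilon>) powr \<epsilon>"
    unfolding b_def using \<epsilon> by (intro powr_mono2) (auto simp: divide_right_mono)
  with k have "b < k" by simp
  with b1 h have hb: "log 2 b < entropy W" "0 < entropy W"
    by (smt (verit) log_less_cancel_iff zero_less_log_cancel_iff)+
  \<comment> \<open>The empty set has entropy 0 here, so positive entropy excludes it; this makes
    the block counts of \<open>W\<close> positive.\<close>
  then have W: "W \<noteq> {}" using entropy_empty by (metis less_irrefl)
  have "eventually (\<lambda>n. log 2 b < log 2 (real (card (blocks n W))) / real n) sequentially"
    using entropy_LIMSEQ hb(1) by (rule order_tendstoD)
  then have "eventually (\<lambda>n. \<epsilon> * log 2 (real ?S) \<le> log 2 (real (card (blocks n X))) / real n)
      sequentially"
    using eventually_gt_at_top[of 0]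
  proof eventually_elim
    case (elim n)
    have cW: "card (blocks n W) > 0"
      using blocks_nonempty[OF W] by (simp add: card_gt_0_iff)
    have "log 2 (b powr real n) < log 2 (real (card (blocks n W)))"
      using elim b1 by (simp add: log_powr pos_less_divide_eq mult.commute)
    then have "b powr real n < real (card (blocks n W))"
      using b1 cW by simp
    moreover have "b powr real n = (exp 1 / \<epsilon>) powr (\<epsilon> * real n)"
      by (simp add: b_def powr_powr)
    ultimately have lt: "card {a. length a = n \<and> real (count_list a PlayerB) \<le> \<epsilon> * real n}
        < card (blocks n W)"
      using card_few_PlayerB_le[OF \<epsilon>, of n] by linarith
    have "\<not> blocks n W \<subseteq> {a. length a = n \<and> real (count_list a PlayerB) \<le> \<epsilon> * real n}"
    proof
      assume le: "blocks n W \<subseteq> {a. length a = n \<and> real (count_list a PlayerB) \<le> \<epsilon> * real n}"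
      have "finite {a. length a = n \<and> real (count_list a PlayerB) \<le> \<epsilon> * real n}"
        by (rule finite_subset[OF _ finite_lists_length_eq[of UNIV n]]) auto
      from card_mono[OF this le] lt show False by linarith
    qed
    then obtain a where a: "a \<in> blocks n W" "\<epsilon> * real n < real (count_list a PlayerB)"
      by (force simp: blocks_def not_le)
    then have "?S ^ count_list a PlayerB \<le> card (blocks n X)"
      using sub by (intro winning_set_card_ge) auto
    then have "real ?S ^ count_list a PlayerB \<le> real (card (blocks n X))"
      by (metis of_nat_le_iff of_nat_power)
    then have "log 2 (real ?S ^ count_list a PlayerB) \<le> log 2 (real (card (blocks n X)))"
      using S by (intro log_mono) auto
    moreover have "\<epsilon> * real n * log 2 (real ?S) \<le> real (count_list a PlayerB) * log 2 (real ?S)"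
      using a(2) S by (intro mult_right_mono) auto
    ultimately have "\<epsilon> * real n * log 2 (real ?S) \<le> log 2 (real (card (blocks n X)))"
      using S by (simp add: log_nat_power)
    then show ?case using elim(2) by (simp add: pos_le_divide_eq mult_ac)
  qed
  then show ?thesis
    by (intro tendsto_lowerbound[OF entropy_LIMSEQ]) auto
qed

text \<open>As \<open>\<epsilon>\<close> tends to 0 from above,
  \<open>(2 * exp 1 / \<epsilon>) powr \<epsilon>\<close> tends to 1, hence drops below
  \<open>2 powr entropy W\<close>, which serves as \<open>k\<close>. Two letters make the resulting
  bound positive. Over a single letter A wins every turn order for nonempty \<open>X\<close>, so the
  winning shift has entropy 1 while \<open>X\<close> has entropy 0.\<close>

lemma entropy_pos_of_blocks_winning:
  fixes X :: "('i::semiring_1 \<Rightarrow> 's::finite) set" and W :: "('i \<Rightarrow> player) set"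
  assumes sub: "\<And>n. blocks n W \<subseteq> winning_set n (blocks n X)"
    and S: "card (UNIV :: 's set) \<ge> 2" and h: "entropy W > 0"
  shows "entropy X > 0"
proof -
  let ?k = "2 powr entropy W"
  have "((\<lambda>\<epsilon>::real. (2 * exp 1 / \<epsilon>) powr \<epsilon>) \<longlongrightarrow> 1) (at_right 0)"
    by real_asymp
  then have "eventually (\<lambda>\<epsilon>. (2 * exp 1 / \<epsilon>) powr \<epsilon> < ?k) (at_right 0)"
    using h by (intro order_tendstoD) auto
  moreover have "eventually (\<lambda>\<epsilon>::real. \<epsilon> \<in> {0<..<1}) (at_right 0)"
    by (rule eventually_at_right_real) simp
  ultimately have "eventually (\<lambda>\<epsilon>. (2 * exp 1 / \<epsilon>) powr \<epsilon> < ?k \<and> \<epsilon> \<in> {0<..<1}) (at_right 0)"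
    by (rule eventually_conj)
  then obtain \<epsilon> where "(2 * exp 1 / \<epsilon>) powr \<epsilon> < ?k" "0 < \<epsilon>" "\<epsilon> < 1"
    using eventually_happens[of _ "at_right (0::real)"] by auto
  then have "\<epsilon> * log 2 (real (card (UNIV :: 's set))) \<le> entropy X"
    using sub by (intro entropy_ge_of_blocks_winning[where k = ?k and W = W]) auto
  moreover have "\<epsilon> * log 2 (real (card (UNIV :: 's set))) > 0"
    using S \<open>0 < \<epsilon>\<close> by simp
  ultimately show ?thesis by linarith
qed

subsection \<open>Blocks of winning shifts\<close>

text \<open>After \<open>i\<close> moves the rest is again a game, with shifted turn order and with
  strategies that see the word already played as a prefix.\<close>

lemma play_add:
  "play a \<sigma> \<tau> (i + n) = play a \<sigma> \<tau> i @
     play (\<lambda>j. a (i + j)) (\<lambda>v. \<sigma> (play a \<sigma> \<tau> i @ v)) (\<lambda>v. \<tau> (play a \<sigma> \<tau> i @ v)) n"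
proof (induction n)
  case (Suc n)
  then show ?case by (cases "a (i + n)") (auto simp: Let_def)
qed simp

lemma play_nth:
  assumes "j < n"
  shows "play a \<sigma> \<tau> n ! j = infinite_play a \<sigma> \<tau> j"
  using assms
  by (induction n) (auto simp: Let_def nth_append less_Suc_eq infinite_play_def)

text \<open>If \<open>w\<close> occurs at position \<open>i\<close> of a winning turn order, A's
  infinite strategy, resumed after \<open>i\<close> moves, wins the game on \<open>w\<close>: the
  word it builds is a factor at \<open>i\<close> of a point of \<open>X\<close>.\<close>

lemma blocks_winning_shift_nat:
  fixes X :: "(nat \<Rightarrow> 's) set"
  shows "blocks n (winning_shift_nat X) \<subseteq> winning_set n (blocks n X)"
proof
  fix w assume "w \<in> blocks n (winning_shift_nat X)"
  then obtain a i where len: "length w = n" and a: "a \<in> winning_shift_nat X"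
    and w: "\<And>j. j < n \<Longrightarrow> a (i + j) = w ! j"
    by (auto simp: blocks_def occurs_in_def)
  obtain \<sigma> where \<sigma>: "\<And>\<tau>. infinite_play a \<sigma> \<tau> \<in> X"
    using a by (auto simp: winning_shift_nat_def)
  \<comment> \<open>A's finite strategy must be fixed before B's is known, so the prefix
    \<open>u\<close> is played against a constant dummy strategy of B.\<close>
  define u where "u = play a \<sigma> (\<lambda>_. undefined) i"
  have "play (\<lambda>j. w ! j) (\<lambda>v. \<sigma> (u @ v)) \<tau> n \<in> blocks n X" for \<tau>
  proof -
    \<comment> \<open>\<open>\<tau>'\<close> plays the dummy letter during the first
      \<open>i\<close> moves and afterwards answers as \<open>\<tau>\<close> does to the word with
      its prefix of length \<open>i\<close> removed.\<close>
    define \<tau>' where "\<tau>' v = (if length v < i then undefined else \<tau> (drop i v))" for v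
    have u: "play a \<sigma> \<tau>' i = u"
      unfolding u_def by (rule play_cong) (auto simp: \<tau>'_def)
    have lu: "length u = i" by (simp add: u_def)
    have "(\<lambda>v. \<tau>' (u @ v)) = \<tau>"
      using lu by (auto simp: \<tau>'_def)
    then have "play a \<sigma> \<tau>' (i + n) = u @ play (\<lambda>j. a (i + j)) (\<lambda>v. \<sigma> (u @ v)) \<tau> n"
      using play_add[of a \<sigma> \<tau>' i n] by (simp add: u)
    also have "play (\<lambda>j. a (i + j)) (\<lambda>v. \<sigma> (u @ v)) \<tau> n = play (\<lambda>j. w ! j) (\<lambda>v. \<sigma> (u @ v)) \<tau> n"
      using w by (intro play_cong) auto
    finally have "infinite_play a \<sigma> \<tau>' (i + j) = play (\<lambda>j. w ! j) (\<lambda>v. \<sigma> (u @ v)) \<tau> n ! j"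
      if "j < n" for j
      using that lu play_nth[of "i + j" "i + n" a \<sigma> \<tau>'] by (simp add: nth_append)
    then have "occurs_in (play (\<lambda>j. w ! j) (\<lambda>v. \<sigma> (u @ v)) \<tau> n) (infinite_play a \<sigma> \<tau>')"
      by (auto simp: occurs_in_def)
    then show ?thesis using \<sigma> by (auto simp: blocks_def)
  qed
  then show "w \<in> winning_set n (blocks n X)"
    using len by (auto simp: winning_set_def)
qed

text \<open>A block that were no winning turn order would itself be one of the forbidden words
  defining the shift.\<close>

lemma blocks_winning_shift_int:
  fixes X :: "(int \<Rightarrow> 's) set"
  shows "blocks n (winning_shift_int X) \<subseteq> winning_set n (blocks n X)"
proof
  fix w assume "w \<in> blocks n (winning_shift_int X)"
  then have len: "length w = n" and "w \<in> winning_language (shift_language X)"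
    by (auto simp: blocks_def winning_shift_int_def shift_avoiding_def)
  then have "w \<in> winning_set n {v \<in> shift_language X. length v = n}"
    by (auto simp: winning_language_def winning_set_def)
  moreover have "{v \<in> shift_language X. length v = n} = blocks n X"
    by (auto simp: shift_language_def blocks_def)
  ultimately show "w \<in> winning_set n (blocks n X)" by simp
qed

theorem proposition5p3:
  "(\<forall>X :: (nat \<Rightarrow> 's::finite) set. subshift X \<longrightarrow>
      (\<forall>(k::real) (\<epsilon>::real).
         entropy (winning_shift_nat X) \<ge> log 2 k \<and> 0 < \<epsilon> \<and> \<epsilon> < 1 \<and>
         (2 * exp 1 / \<epsilon>) powr \<epsilon> < k \<longrightarrow>
         entropy X \<ge> \<epsilon> * log 2 (real (card (UNIV :: 's set)))) \<and>
      (card (UNIV :: 's set) \<ge> 2 \<longrightarrow> entropy (winning_shift_nat X) > 0 \<longrightarrow> entropy X > 0)) \<and>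
   (\<forall>X :: (int \<Rightarrow> 's) set. subshift X \<longrightarrow>
      (\<forall>(k::real) (\<epsilon>::real).
         entropy (winning_shift_int X) \<ge> log 2 k \<and> 0 < \<epsilon> \<and> \<epsilon> < 1 \<and>
         (2 * exp 1 / \<epsilon>) powr \<epsilon> < k \<longrightarrow>
         entropy X \<ge> \<epsilon> * log 2 (real (card (UNIV :: 's set)))) \<and>
      (card (UNIV :: 's set) \<ge> 2 \<longrightarrow> entropy (winning_shift_int X) > 0 \<longrightarrow> entropy X > 0))"
  \<comment> \<open>Four goals arise, two for each index type: the type of \<open>X\<close> selects
    the block inclusion, and the shape of the conclusion selects the entropy bound or its
    positivity.\<close>
  by (intro conjI allI impI; (elim conjE)?;
      rule entropy_ge_of_blocks_winning[OF blocks_winning_shift_nat]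
        entropy_pos_of_blocks_winning[OF blocks_winning_shift_nat]
        entropy_ge_of_blocks_winning[OF blocks_winning_shift_int]
        entropy_pos_of_blocks_winning[OF blocks_winning_shift_int];
      assumption)

end
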